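(* Let $R$ be a non-discrete irreducible, continuous ring, and let $S$ be a subring of $R$ containing the center $\mathrm{Z}(R)$. If $\dim_{\mathrm{Z}(R)}(S)<\infty$, then there exists a maximal chain $F$ in $(\mathrm{L}(R),\subseteq)$ such that $S\subseteq R_F$, i.e., $aI\subseteq I$ for all $a\in S$ and all $I\in F$.
   Context: A unital ring $R$ is (von Neumann) regular if for every $a\in R$ there is $b\in R$ with $aba=a$. For such $R$, the set $\mathrm{L}(R)=\{aR\mid a\in R\}$ ordered by inclusion is a complemented modular lattice. A continuous ring is a regular ring $R$ such that $\mathrm{L}(R)$ is a continuous geometry, i.e., additionally a complete lattice such that for every chain $C\subseteq \mathrm{L}(R)$ and every $x\in\mathrm{L}(R)$ one has $x\wedge\bigvee C=\bigvee\{x\wedge y\mid y\in C\}$ and $x\vee\bigwedge C=\bigwedge\{x\vee y\mid y\in C\}$. A ring is irreducible if it is non-zero and not isomorphic to a direct product of two non-zero rings. A rank function on a regular ring $R$ is a map $\rho\colon R\to[0,1]$ with $\rho(1)=1$, $\rho(ab)\le\min\{\rho(a),\rho(b)\}$ for all $a,b\in R$, $\rho(e+f)=\rho(e)+\rho(f)$ for all idempotents $e,f$ with $ef=fe=0$, and $\rho(a)>0$ for $a\ne0$. Every irreducible, continuous ring $R$ has a unique rank function $\rho_R$ (von Neumann), and $d_R(a,b):=\rho_R(a-b)$ is a complete metric on $R$; $R$ is non-discrete if the topology generated by $d_R$ is not discrete. The center $\mathrm{Z}(R)$ of an irreducible regular ring is a field, and $\dim_{\mathrm{Z}(R)}(S)$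 is the minimal cardinality of a generating set of the $\mathrm{Z}(R)$-module $S$ (with value $\infty$ if $S$ is not finitely generated). For $F\subseteq\mathrm{L}(R)$, $R_F:=\{a\in R\mid aI\subseteq I\text{ for all }I\in F\}$. A maximal chain is a chain that is maximal with respect to inclusion among chains. *)

theory Defs
  imports "HOL-Analysis.Analysis" "HOL-Algebra.Algebra"
begin

locale regular_ring = ring R for R (structure) +
  assumes regular: "a \<in> carrier R \<Longrightarrow> \<exists>b\<in>carrier R. a \<otimes> b \<otimes> a = a"

definition principal_right_ideals :: "('a, 'm) ring_scheme \<Rightarrow> 'a set set" where
  "principal_right_ideals R = {a <#\<^bsub>R\<^esub> carrier R | a. a \<in> carrier R}"

definition right_ideal_lattice :: "('a, 'm) ring_scheme \<Rightarrow> 'a set gorder" where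
  "right_ideal_lattice R =
     \<lparr>carrier = principal_right_ideals R, eq = (=), le = (\<subseteq>)\<rparr>"

locale continuous_geometry = complete_lattice L for L (structure) +
  assumes complemented:
    "x \<in> carrier L \<Longrightarrow> \<exists>y\<in>carrier L. x \<sqinter> y = \<bottom> \<and> x \<squnion> y = \<top>"
  and modular:
    "\<lbrakk>x \<in> carrier L; y \<in> carrier L; z \<in> carrier L; x \<sqsubseteq> z\<rbrakk>
       \<Longrightarrow> x \<squnion> (y \<sqinter> z) = (x \<squnion> y) \<sqinter> z"
  and meet_continuous:
    "\<lbrakk>C \<subseteq> carrier L; \<forall>u\<in>C. \<forall>v\<in>C. u \<sqsubseteq> v \<or> v \<sqsubseteq> u; x \<in> carrier L\<rbrakk>
       \<Longrightarrow> x \<sqinter> \<Squnion>C = \<Squnion>{x \<sqinter> y | y. y \<in> C}"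
  and join_continuous:
    "\<lbrakk>C \<subseteq> carrier L; \<forall>u\<in>C. \<forall>v\<in>C. u \<sqsubseteq> v \<or> v \<sqsubseteq> u; x \<in> carrier L\<rbrakk>
       \<Longrightarrow> x \<squnion> \<Sqinter>C = \<Sqinter>{x \<squnion> y | y. y \<in> C}"

locale continuous_ring = regular_ring R for R (structure) +
  assumes continuous_geometry: "continuous_geometry (right_ideal_lattice R)"

text \<open>Taking the factors on the element type of \<open>R\<close> is no restriction: if \<open>R\<close> is isomorphic
  to a product of rings of any types, each factor embeds as a set into \<open>R\<close>, so its structure
  can be transported to that type.\<close>

definition irreducible_ring :: "('a, 'm) ring_scheme \<Rightarrow> bool" where
  "irreducible_ring R \<longleftrightarrow>
     ring R \<and> carrier R \<noteq> {\<zero>\<^bsub>R\<^esub>} \<and>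
     \<not> (\<exists>(A :: 'a ring) (B :: 'a ring).
          ring A \<and> ring B \<and> carrier A \<noteq> {\<zero>\<^bsub>A\<^esub>} \<and> carrier B \<noteq> {\<zero>\<^bsub>B\<^esub>} \<and>
          is_ring_iso R (RDirProd A B))"

definition rank_function :: "('a, 'm) ring_scheme \<Rightarrow> ('a \<Rightarrow> real) \<Rightarrow> bool" where
  "rank_function R \<rho> \<longleftrightarrow>
     \<rho> \<in> carrier R \<rightarrow> {0..1} \<and>
     \<rho> \<one>\<^bsub>R\<^esub> = 1 \<and>
     (\<forall>a\<in>carrier R. \<forall>b\<in>carrier R. \<rho> (a \<otimes>\<^bsub>R\<^esub> b) \<le> min (\<rho> a) (\<rho> b)) \<and>
     (\<forall>e\<in>carrier R. \<forall>f\<in>carrier R.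
        e \<otimes>\<^bsub>R\<^esub> e = e \<and> f \<otimes>\<^bsub>R\<^esub> f = f \<and> e \<otimes>\<^bsub>R\<^esub> f = \<zero>\<^bsub>R\<^esub> \<and> f \<otimes>\<^bsub>R\<^esub> e = \<zero>\<^bsub>R\<^esub>
          \<longrightarrow> \<rho> (e \<oplus>\<^bsub>R\<^esub> f) = \<rho> e + \<rho> f) \<and>
     (\<forall>a\<in>carrier R. a \<noteq> \<zero>\<^bsub>R\<^esub> \<longrightarrow> \<rho> a > 0)"

text \<open>Off the carrier the distance is set to 0 because \<open>Metric_space\<close> demands a nonnegative,
  symmetric function on the whole type.\<close>

definition rank_dist :: "('a, 'm) ring_scheme \<Rightarrow> ('a \<Rightarrow> real) \<Rightarrow> 'a \<Rightarrow> 'a \<Rightarrow> real" where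
  "rank_dist R \<rho> a b =
     (if a \<in> carrier R \<and> b \<in> carrier R then \<rho> (a \<ominus>\<^bsub>R\<^esub> b) else 0)"

text \<open>Only meant for irreducible, continuous rings. By a theorem of von Neumann such a ring has
  exactly one rank function (up to its values off the carrier, which are irrelevant here), and
  \<open>\<rho>\<close> below is that function.\<close>

definition nondiscrete_ring :: "('a, 'm) ring_scheme \<Rightarrow> bool" where
  "nondiscrete_ring R \<longleftrightarrow>
     (\<exists>\<rho>. rank_function R \<rho> \<and>
          Metric_space.mtopology (carrier R) (rank_dist R \<rho>) \<noteq> discrete_topology (carrier R))"

definition ring_center :: "('a, 'm) ring_scheme \<Rightarrow> 'a set" where
  "ring_center R = {a \<in> carrier R. \<forall>b\<in>carrier R. a \<otimes>\<^bsub>R\<^esub> b = b \<otimes>\<^bsub>R\<^esub> a}"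

text \<open>The minimal cardinality of a generating set of the \<open>K\<close>-submodule \<open>M\<close> of \<open>R\<close>. Finite
  generating sets are listed, as \<open>ring.Span\<close> takes a list; without any the infimum is \<open>\<infinity>\<close>.\<close>

definition module_dim :: "('a, 'm) ring_scheme \<Rightarrow> 'a set \<Rightarrow> 'a set \<Rightarrow> enat" where
  "module_dim R K M =
     (INF us \<in> {us. set us \<subseteq> M \<and> ring.Span R K us = M}. enat (card (set us)))"

definition stabilizer_ring :: "('a, 'm) ring_scheme \<Rightarrow> 'a set set \<Rightarrow> 'a set" where
  "stabilizer_ring R F = {a \<in> carrier R. \<forall>I\<in>F. a <#\<^bsub>R\<^esub> I \<subseteq> I}"

end

theory Submission
  imports Defs
begin

text \<open>Let \<open>F\<close> be a maximal chain of \<open>S\<close>-invariant principal right ideals. Invariant ideals are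
  closed under arbitrary joins and meets, so if some \<open>M \<notin> F\<close> were comparable with all of \<open>F\<close>,
  then \<open>M\<close> would lie strictly between two members \<open>I \<subset> J\<close> of \<open>F\<close> with no member of \<open>F\<close> between
  them. Choose \<open>0 \<noteq> f = f\<^sup>2 \<in> J\<close> with \<open>f I = 0\<close>. Since \<open>R\<close> is prime and not discrete,
  \<open>f R\<close> contains some \<open>x \<noteq> 0\<close> of arbitrarily small rank. The ideal \<open>I + S x R\<close> is invariant and
  lies between \<open>I\<close> and \<open>J\<close>, and if \<open>S\<close> is generated by \<open>n\<close> elements over the center, then
  \<open>S x R\<close> is the sum of \<open>n\<close> ideals of rank at most \<open>\<rho> x\<close>. For \<open>n \<rho> x < \<rho> f\<close> it is therefore
  strictly between them, which contradicts the maximality of \<open>F\<close>.\<close>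

text \<open>For a central idempotent \<open>e\<close> this is the ideal \<open>e R\<close> as a ring
  with unit \<open>e\<close>. The carrier consists of the elements fixed by \<open>e\<close>, so
  that membership is an equation.\<close>

definition corner :: "('a, 'm) ring_scheme \<Rightarrow> 'a \<Rightarrow> 'a ring" where
  "corner R e = \<lparr>carrier = {x \<in> carrier R. e \<otimes>\<^bsub>R\<^esub> x = x}, mult = mult R, one = e,
     ring.zero = \<zero>\<^bsub>R\<^esub>, ring.add = add R\<rparr>"

text \<open>The generators form a list so that the recursion runs parallel to that of
  \<open>Span\<close>, and a bound on ranks becomes a sum over the list.\<close>

definition right_span :: "('a, 'm) ring_scheme \<Rightarrow> 'a list \<Rightarrow> 'a set" where
  "right_span R vs = foldr (\<lambda>v N. (v <#\<^bsub>R\<^esub> carrier R) <+>\<^bsub>R\<^esub> N) vs {\<zero>\<^bsub>R\<^esub>}"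

section \<open>Central idempotents and direct decompositions\<close>

context ring
begin

lemma one_minus_idempotent:
  assumes e: "e \<in> carrier R" "e \<otimes> e = e"
  shows "(\<one> \<ominus> e) \<otimes> e = \<zero>" "e \<otimes> (\<one> \<ominus> e) = \<zero>" "(\<one> \<ominus> e) \<otimes> (\<one> \<ominus> e) = \<one> \<ominus> e"
proof -
  show 1: "(\<one> \<ominus> e) \<otimes> e = \<zero>" and 2: "e \<otimes> (\<one> \<ominus> e) = \<zero>"
    using e by (simp_all add: minus_eq l_distr r_distr l_minus r_minus r_neg)
  have "(\<one> \<ominus> e) \<otimes> (\<one> \<ominus> e) = (\<one> \<ominus> e) \<ominus> e \<otimes> (\<one> \<ominus> e)"
    using e by (simp add: minus_eq l_distr l_minus)
  then show "(\<one> \<ominus> e) \<otimes> (\<one> \<ominus> e) = \<one> \<ominus> e"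
    using e 2 by (simp add: minus_eq)
qed

text \<open>Turns membership in a right ideal given by an idempotent into an annihilation
  condition.\<close>

lemma one_minus_mult_eq_zero_iff:
  assumes "e \<in> carrier R" "x \<in> carrier R"
  shows "(\<one> \<ominus> e) \<otimes> x = \<zero> \<longleftrightarrow> e \<otimes> x = x"
proof -
  have "(\<one> \<ominus> e) \<otimes> x = x \<ominus> e \<otimes> x"
    using assms by (simp add: minus_eq l_distr l_minus)
  then show ?thesis
    using assms r_right_minus_eq[of x "e \<otimes> x"] by auto
qed

lemma ring_center_closed: "c \<in> ring_center R \<Longrightarrow> c \<in> carrier R"
  unfolding ring_center_def by blast

lemma ring_center_commute: "c \<in> ring_center R \<Longrightarrow> x \<in> carrier R \<Longrightarrow> c \<otimes> x = x \<otimes> c"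
  unfolding ring_center_def by blast

text \<open>The carrier makes \<open>e\<close> a left unit by definition; centrality makes it a
  right unit too.\<close>

lemma ring_corner:
  assumes e: "e \<in> ring_center R" "e \<otimes> e = e"
  shows "ring (corner R e)"
proof -
  note ec = ring_center_closed[OF e(1)] and comm = ring_center_commute[OF e(1)]
  show ?thesis
  proof (rule ringI)
    show "abelian_group (corner R e)"
    proof (rule abelian_groupI)
      fix x assume x: "x \<in> carrier (corner R e)"
      then show "\<exists>y \<in> carrier (corner R e). y \<oplus>\<^bsub>corner R e\<^esub> x = \<zero>\<^bsub>corner R e\<^esub>"
        using ec by (auto simp: corner_def r_minus l_neg intro!: bexI[of _ "\<ominus> x"])
    qed (use ec in \<open>auto simp: corner_def r_distr a_ac\<close>)
    show "monoid (corner R e)"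
    proof (rule monoidI)
      fix x y assume "x \<in> carrier (corner R e)" "y \<in> carrier (corner R e)"
      then show "x \<otimes>\<^bsub>corner R e\<^esub> y \<in> carrier (corner R e)"
        using ec by (auto simp: corner_def m_assoc[symmetric])
    next
      fix x assume "x \<in> carrier (corner R e)"
      then show "x \<otimes>\<^bsub>corner R e\<^esub> \<one>\<^bsub>corner R e\<^esub> = x"
        using comm[of x] by (auto simp: corner_def)
    qed (use ec e in \<open>auto simp: corner_def m_assoc\<close>)
  qed (auto simp: corner_def l_distr r_distr)
qed

lemma one_minus_central:
  assumes "e \<in> ring_center R"
  shows "\<one> \<ominus> e \<in> ring_center R"
proof -
  have "(\<one> \<ominus> e) \<otimes> x = x \<otimes> (\<one> \<ominus> e)" if "x \<in> carrier R" for x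
    using that ring_center_closed[OF assms] ring_center_commute[OF assms that]
    by (simp add: minus_eq l_distr r_distr l_minus r_minus)
  then show ?thesis
    using ring_center_closed[OF assms] unfolding ring_center_def by blast
qed

text \<open>Any other central idempotent would split the ring into the two non-zero corners of
  \<open>e\<close> and \<open>\<one> \<ominus> e\<close>, by the Peirce decomposition.\<close>

lemma irreducible_central_idempotent:
  assumes irr: "irreducible_ring R" and e: "e \<in> ring_center R" "e \<otimes> e = e"
  shows "e = \<zero> \<or> e = \<one>"
proof (rule ccontr)
  assume nontriv: "\<not> (e = \<zero> \<or> e = \<one>)"
  define u where "u = \<one> \<ominus> e"
  note ec = ring_center_closed[OF e(1)] and comm = ring_center_commute[OF e(1)]
  have u: "u \<in> ring_center R" "u \<otimes> u = u" "u \<in> carrier R" "u \<otimes> e = \<zero>" "e \<otimes> u = \<zero>"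
    using one_minus_central[OF e(1)] one_minus_idempotent[OF ec e(2)] ec by (auto simp: u_def)
  have eu: "e \<oplus> u = \<one>"
    using ec by (simp add: u_def minus_eq) (metis a_comm a_inv_closed a_lcomm one_closed r_neg r_zero)
  have une: "u \<noteq> \<zero>"
    using eu ec nontriv by auto
  have decomp: "e \<otimes> x \<oplus> u \<otimes> x = x" if "x \<in> carrier R" for x
    using that eu ec u l_distr[of e u x] by simp
  \<comment> \<open>Centrality moves the second \<open>g\<close> past \<open>x\<close>, and
    idempotence merges the two copies.\<close>
  have mul: "g \<otimes> (x \<otimes> y) = (g \<otimes> x) \<otimes> (g \<otimes> y)"
    if "g \<in> ring_center R" "g \<otimes> g = g" "x \<in> carrier R" "y \<in> carrier R" for g x y
  proof -
    have g: "g \<in> carrier R" and gx: "g \<otimes> x = x \<otimes> g"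
      using that ring_center_closed ring_center_commute by auto
    have "(g \<otimes> x) \<otimes> (g \<otimes> y) = g \<otimes> (x \<otimes> g) \<otimes> y"
      using that g by (simp add: m_assoc)
    also have "\<dots> = (g \<otimes> g) \<otimes> x \<otimes> y"
      unfolding gx[symmetric] using that(3,4) g by (simp add: m_assoc)
    finally show ?thesis using that g by (simp add: m_assoc)
  qed
  have idem: "g \<otimes> (g \<otimes> x) = g \<otimes> x"
    if "g \<in> carrier R" "g \<otimes> g = g" "x \<in> carrier R" for g x
    using that by (simp add: m_assoc[symmetric])
  have zer: "g \<otimes> (h \<otimes> x) = \<zero>"
    if "g \<in> carrier R" "h \<in> carrier R" "g \<otimes> h = \<zero>" "x \<in> carrier R" for g h x
    using that by (simp add: m_assoc[symmetric])
  have "(\<lambda>x. (e \<otimes> x, u \<otimes> x)) \<in> ring_iso R (RDirProd (corner R e) (corner R u))"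
  proof (rule ring_iso_memI)
    show "bij_betw (\<lambda>x. (e \<otimes> x, u \<otimes> x)) (carrier R)
            (carrier (RDirProd (corner R e) (corner R u)))"
    \<comment> \<open>The inverse map is addition: each corner is annihilated by the complementary
      idempotent.\<close>
    proof (rule bij_betw_byWitness[where f' = "\<lambda>(a, b). a \<oplus> b"])
      show "\<forall>ab \<in> carrier (RDirProd (corner R e) (corner R u)).
        (\<lambda>x. (e \<otimes> x, u \<otimes> x)) (case ab of (a, b) \<Rightarrow> a \<oplus> b) = ab"
      proof
        fix ab assume "ab \<in> carrier (RDirProd (corner R e) (corner R u))"
        then obtain a b where ab: "ab = (a, b)" "a \<in> carrier R" "e \<otimes> a = a"
            "b \<in> carrier R" "u \<otimes> b = b"
          by (auto simp: RDirProd_carrier corner_def)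
        have "e \<otimes> b = \<zero>" using zer[of e u b] ab ec u by simp
        moreover have "u \<otimes> a = \<zero>" using zer[of u e a] ab ec u by simp
        ultimately show "(\<lambda>x. (e \<otimes> x, u \<otimes> x)) (case ab of (a, b) \<Rightarrow> a \<oplus> b) = ab"
          using ab ec u by (simp add: r_distr)
      qed
    qed (use ec u e decomp idem in \<open>auto simp: RDirProd_carrier corner_def\<close>)
  qed (use ec u e idem mul in
      \<open>auto simp: RDirProd_def DirProd_def monoid.defs corner_def r_distr\<close>)
  then have iso: "is_ring_iso R (RDirProd (corner R e) (corner R u))"
    by (auto simp: is_ring_iso_def)
  moreover have nonzero: "carrier (corner R g) \<noteq> {\<zero>\<^bsub>corner R g\<^esub>}"
    if "g \<in> carrier R" "g \<otimes> g = g" "g \<noteq> \<zero>" for g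
    using that by (auto simp: corner_def)
  have "carrier (corner R e) \<noteq> {\<zero>\<^bsub>corner R e\<^esub>}"
    and "carrier (corner R u) \<noteq> {\<zero>\<^bsub>corner R u\<^esub>}"
    using nontriv une nonzero[OF ec e(2)] nonzero[OF u(3,2)] by simp_all
  then have "\<exists>(A :: 'a ring) (B :: 'a ring). ring A \<and> ring B \<and> carrier A \<noteq> {\<zero>\<^bsub>A\<^esub>} \<and>
      carrier B \<noteq> {\<zero>\<^bsub>B\<^esub>} \<and> is_ring_iso R (RDirProd A B)"
    using ring_corner[OF e] ring_corner[OF u(1,2)] iso by (intro exI conjI)
  then show False
    using irr by (simp only: irreducible_ring_def not_True_eq_False simp_thms)
qed

end

section \<open>Principal right ideals of a regular ring\<close>

context regular_ring
begin

text \<open>If \<open>a \<otimes> b \<otimes> a = a\<close>, then \<open>a \<otimes> b\<close> is an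
  idempotent generating the same right ideal as \<open>a\<close>, and the ideal generated by an
  idempotent is its set of fixed points. Ideals are handled through this equation below.\<close>

lemma principal_right_idealE:
  assumes "I \<in> principal_right_ideals R"
  obtains e where "e \<in> carrier R" "e \<otimes> e = e" "I = {x \<in> carrier R. e \<otimes> x = x}"
proof -
  obtain a where a: "a \<in> carrier R" "I = a <# carrier R"
    using assms by (auto simp: principal_right_ideals_def)
  obtain b where b: "b \<in> carrier R" "a \<otimes> b \<otimes> a = a" using regular a by blast
  have "(a \<otimes> b) \<otimes> (a \<otimes> b) = a \<otimes> b"
    using a b by (metis m_assoc m_closed)
  moreover have "I = {x \<in> carrier R. (a \<otimes> b) \<otimes> x = x}"
  proof (intro Set.set_eqI iffI)
    fix x assume "x \<in> I"
    then show "x \<in> {x \<in> carrier R. (a \<otimes> b) \<otimes> x = x}"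
      using a b by (auto simp: l_coset_def m_assoc[symmetric])
  next
    fix x assume "x \<in> {x \<in> carrier R. (a \<otimes> b) \<otimes> x = x}"
    then show "x \<in> I"
      using a b by (auto simp: l_coset_def m_assoc intro!: bexI[of _ "b \<otimes> x"])
  qed
  ultimately show ?thesis using that a b by blast
qed

lemma principal_right_idealI:
  assumes "e \<in> carrier R" "e \<otimes> e = e"
  shows "{x \<in> carrier R. e \<otimes> x = x} \<in> principal_right_ideals R"
proof -
  have "{x \<in> carrier R. e \<otimes> x = x} = e <# carrier R"
  proof (intro Set.set_eqI iffI)
    fix x assume "x \<in> {x \<in> carrier R. e \<otimes> x = x}"
    then show "x \<in> e <# carrier R"
      by (force simp: l_coset_def)
  next
    fix x assume "x \<in> e <# carrier R"
    then show "x \<in> {x \<in> carrier R. e \<otimes> x = x}"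
      using assms by (auto simp: l_coset_def m_assoc[symmetric])
  qed
  then show ?thesis using assms by (auto simp: principal_right_ideals_def)
qed

lemma principal_right_ideal_generated:
  assumes "a \<in> carrier R"
  shows "a <# carrier R \<in> principal_right_ideals R" "a \<in> a <# carrier R"
  using assms by (auto simp: principal_right_ideals_def l_coset_def intro!: bexI[of _ \<one>])

lemma principal_right_ideal_closed:
  assumes "I \<in> principal_right_ideals R"
  shows "I \<subseteq> carrier R" "\<zero> \<in> I"
    "\<And>x y. x \<in> I \<Longrightarrow> y \<in> I \<Longrightarrow> x \<oplus> y \<in> I"
    "\<And>x r. x \<in> I \<Longrightarrow> r \<in> carrier R \<Longrightarrow> x \<otimes> r \<in> I"
proof -
  obtain e where "e \<in> carrier R" "I = {x \<in> carrier R. e \<otimes> x = x}"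
    using principal_right_idealE assms by metis
  then show "I \<subseteq> carrier R" "\<zero> \<in> I"
    "\<And>x y. x \<in> I \<Longrightarrow> y \<in> I \<Longrightarrow> x \<oplus> y \<in> I"
    "\<And>x r. x \<in> I \<Longrightarrow> r \<in> carrier R \<Longrightarrow> x \<otimes> r \<in> I"
    by (auto simp: r_distr m_assoc[symmetric])
qed

lemma zero_principal_right_ideal: "{\<zero>} \<in> principal_right_ideals R"
proof -
  have "{x \<in> carrier R. \<zero> \<otimes> x = x} = {\<zero>}" by auto
  then show ?thesis using principal_right_idealI[of \<zero>] by simp
qed

text \<open>With \<open>c \<otimes> b \<otimes> c = c\<close>, the idempotent
  \<open>g = b \<otimes> c\<close> has the same right annihilator as \<open>c\<close>, and that
  annihilator is generated by \<open>\<one> \<ominus> g\<close>.\<close>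

lemma right_annihilator_principal:
  assumes c: "c \<in> carrier R"
  shows "{x \<in> carrier R. c \<otimes> x = \<zero>} \<in> principal_right_ideals R"
proof -
  obtain b where b: "b \<in> carrier R" "c \<otimes> b \<otimes> c = c" using regular c by blast
  define g where "g = b \<otimes> c"
  have g: "g \<in> carrier R" "g \<otimes> g = g" "c \<otimes> g = c"
    using b c unfolding g_def by (auto simp: m_assoc)
  have "{x \<in> carrier R. c \<otimes> x = \<zero>} = {x \<in> carrier R. (\<one> \<ominus> g) \<otimes> x = x}"
  proof (intro Set.set_eqI iffI)
    fix x assume x: "x \<in> {x \<in> carrier R. c \<otimes> x = \<zero>}"
    then have "g \<otimes> x = \<zero>" using b c by (simp add: g_def m_assoc)
    then show "x \<in> {x \<in> carrier R. (\<one> \<ominus> g) \<otimes> x = x}"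
      using x g by (simp add: minus_eq l_distr l_minus)
  next
    fix x assume x: "x \<in> {x \<in> carrier R. (\<one> \<ominus> g) \<otimes> x = x}"
    have "c \<otimes> (\<one> \<ominus> g) = \<zero>"
      using c g by (simp add: minus_eq r_distr r_minus r_neg)
    moreover have "c \<otimes> ((\<one> \<ominus> g) \<otimes> x) = (c \<otimes> (\<one> \<ominus> g)) \<otimes> x"
      using c g(1) x by (simp add: m_assoc)
    ultimately have "c \<otimes> ((\<one> \<ominus> g) \<otimes> x) = \<zero>" using x by simp
    then show "x \<in> {x \<in> carrier R. c \<otimes> x = \<zero>}" using x by simp
  qed
  then show ?thesis
    using principal_right_idealI[of "\<one> \<ominus> g"] one_minus_idempotent[OF g(1,2)] g by simp
qed

text \<open>The preimage is the right annihilator of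
  \<open>(\<one> \<ominus> e) \<otimes> a\<close>, where \<open>e\<close> is an idempotent
  generating \<open>I\<close>. Such preimages are the test ideals that show joins of invariant
  ideals to be invariant.\<close>

lemma left_multiplication_preimage_principal:
  assumes "I \<in> principal_right_ideals R" and a: "a \<in> carrier R"
  shows "{x \<in> carrier R. a \<otimes> x \<in> I} \<in> principal_right_ideals R"
proof -
  obtain e where e: "e \<in> carrier R" "I = {x \<in> carrier R. e \<otimes> x = x}"
    using principal_right_idealE assms by metis
  have "{x \<in> carrier R. a \<otimes> x \<in> I} = {x \<in> carrier R. ((\<one> \<ominus> e) \<otimes> a) \<otimes> x = \<zero>}"
    using e a by (auto simp: one_minus_mult_eq_zero_iff m_assoc)
  then show ?thesis using right_annihilator_principal[of "(\<one> \<ominus> e) \<otimes> a"] e a by simp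
qed

lemma left_multiplication_image_principal:
  assumes "I \<in> principal_right_ideals R" and a: "a \<in> carrier R"
  shows "a <# I \<in> principal_right_ideals R"
proof -
  obtain c where c: "c \<in> carrier R" "I = c <# carrier R"
    using assms by (auto simp: principal_right_ideals_def)
  have "a <# I = (a \<otimes> c) <# carrier R"
    using c a by (auto simp: l_coset_def m_assoc)
  then show ?thesis using a c by (auto simp: principal_right_ideals_def)
qed

text \<open>A Gram-Schmidt step: \<open>h\<close> generates the part of \<open>b R\<close> left
  after removing its component along \<open>e\<close>, so \<open>e \<oplus> h\<close> acts as a left
  unit on both \<open>e\<close> and \<open>b\<close>. The factorization of \<open>h\<close> through
  \<open>(\<one> \<ominus> e) \<otimes> b\<close> is kept because it bounds the rank of
  \<open>h\<close> and places \<open>h\<close> in ideals containing \<open>e\<close> and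
  \<open>b\<close>.\<close>

lemma orthogonal_idempotent:
  assumes e: "e \<in> carrier R" "e \<otimes> e = e" and b: "b \<in> carrier R"
  obtains h c where "h \<in> carrier R" "h \<otimes> h = h" "e \<otimes> h = \<zero>" "h \<otimes> e = \<zero>"
    "(e \<oplus> h) \<otimes> b = b" "c \<in> carrier R" "h = (\<one> \<ominus> e) \<otimes> b \<otimes> c"
proof -
  define u where "u = \<one> \<ominus> e"
  have u: "u \<in> carrier R" "u \<otimes> e = \<zero>" "e \<otimes> u = \<zero>" "u \<otimes> u = u"
    using one_minus_idempotent[OF e] e by (auto simp: u_def)
  define d where "d = u \<otimes> b"
  have d: "d \<in> carrier R" "u \<otimes> d = d" "e \<otimes> d = \<zero>"
    using u b e by (auto simp: d_def m_assoc[symmetric])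
  obtain c where c: "c \<in> carrier R" "d \<otimes> c \<otimes> d = d" using regular d by blast
  \<comment> \<open>Already \<open>d \<otimes> c\<close> is idempotent and killed by
    \<open>e\<close> from the left. The factor \<open>u\<close> on the right also gives
    \<open>h \<otimes> e = \<zero>\<close>, and it keeps \<open>h \<otimes> d = d\<close> because
    \<open>u \<otimes> d = d\<close>.\<close>
  define h where "h = d \<otimes> (c \<otimes> u)"
  have h: "h \<in> carrier R" using d c u by (simp add: h_def)
  have hd: "h \<otimes> d = d"
    using c d u by (simp add: h_def m_assoc)
  have "h \<otimes> h = h"
  proof -
    have "h \<otimes> h = h \<otimes> (d \<otimes> (c \<otimes> u))" by (simp only: h_def)
    also have "\<dots> = (h \<otimes> d) \<otimes> (c \<otimes> u)" using h c d u by (simp add: m_assoc)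
    finally show ?thesis unfolding hd by (simp add: h_def)
  qed
  moreover have "e \<otimes> h = \<zero>"
    using c d u e by (simp add: h_def m_assoc[symmetric])
  moreover have "h \<otimes> e = \<zero>"
    using c d u e by (simp add: h_def m_assoc)
  moreover have "(e \<oplus> h) \<otimes> b = b"
  proof -
    have "h \<otimes> u = h" using c d u by (simp add: h_def m_assoc)
    then have "h \<otimes> b = (h \<otimes> u) \<otimes> b" by simp
    also have "\<dots> = d" using hd h u b by (simp add: d_def m_assoc)
    finally have "(e \<oplus> h) \<otimes> b = e \<otimes> b \<oplus> d"
      using e h b by (simp add: l_distr)
    also have "\<dots> = (e \<oplus> u) \<otimes> b" using e u b by (simp add: d_def l_distr)
    also have "e \<oplus> u = \<one>"
      using e by (simp add: u_def minus_eq) (metis a_comm a_inv_closed a_lcomm one_closed r_neg r_zero)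
    finally show ?thesis using b by simp
  qed
  ultimately show ?thesis
    using that[of h "c \<otimes> u"] h c u by (simp add: h_def d_def u_def)
qed

lemma add_principal_right_ideals:
  assumes I: "I \<in> principal_right_ideals R" and J: "J \<in> principal_right_ideals R"
  shows "I <+>\<^bsub>R\<^esub> J \<in> principal_right_ideals R"
proof -
  obtain e where e: "e \<in> carrier R" "e \<otimes> e = e" "I = {x \<in> carrier R. e \<otimes> x = x}"
    using principal_right_idealE[OF I] .
  obtain b where b: "b \<in> carrier R" "J = b <# carrier R"
    using J by (auto simp: principal_right_ideals_def)
  obtain h c where h: "h \<in> carrier R" "h \<otimes> h = h" "e \<otimes> h = \<zero>" "h \<otimes> e = \<zero>"
    "(e \<oplus> h) \<otimes> b = b" "c \<in> carrier R" "h = (\<one> \<ominus> e) \<otimes> b \<otimes> c"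
    using orthogonal_idempotent[OF e(1,2) b(1)] .
  \<comment> \<open>As a sum of orthogonal idempotents \<open>g\<close> is idempotent; it will
    generate \<open>I + J\<close>.\<close>
  define g where "g = e \<oplus> h"
  have g: "g \<in> carrier R" "g \<otimes> g = g" "g \<otimes> e = e" "g \<otimes> b = b"
    using e h by (auto simp: g_def l_distr r_distr)
  have gx: "g \<otimes> x = x" if "x \<in> I" for x
  proof -
    have "g \<otimes> x = g \<otimes> (e \<otimes> x)" using that e by simp
    also have "\<dots> = (g \<otimes> e) \<otimes> x" using that e g(1) by (auto simp: m_assoc)
    finally show ?thesis using g that e by simp
  qed
  have "I <+>\<^bsub>R\<^esub> J = {x \<in> carrier R. g \<otimes> x = x}"
  proof (intro Set.set_eqI iffI)
    fix x assume "x \<in> I <+>\<^bsub>R\<^esub> J"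
    then obtain i r where ir: "i \<in> I" "r \<in> carrier R" "x = i \<oplus> b \<otimes> r"
      using b by (auto simp: set_add_def' l_coset_def)
    then have ic: "i \<in> carrier R" using e by simp
    have "g \<otimes> (b \<otimes> r) = b \<otimes> r" using g b ir by (simp add: m_assoc[symmetric])
    then have "g \<otimes> x = x" using ir(2) ic gx[OF ir(1)] b g(1) by (simp add: r_distr ir(3))
    then show "x \<in> {x \<in> carrier R. g \<otimes> x = x}" using ir b e by auto
  next
    fix x assume x: "x \<in> {x \<in> carrier R. g \<otimes> x = x}"
    \<comment> \<open>Since \<open>h \<otimes> x = y - e y\<close>, the fixed point
      \<open>x = e x + h x\<close> regroups as \<open>e (x - y) + y\<close>, with one summand in
      each ideal.\<close>
    define y where "y = b \<otimes> (c \<otimes> x)"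
    have y: "y \<in> carrier R" "y \<in> J" using x b h by (auto simp: y_def l_coset_def)
    have "h \<otimes> x = (\<one> \<ominus> e) \<otimes> y"
      using h(6,7) b e x by (simp add: y_def m_assoc)
    also have "\<dots> = y \<oplus> \<ominus> (e \<otimes> y)"
      using y e by (simp add: minus_eq l_distr l_minus)
    finally have hx: "h \<otimes> x = y \<oplus> \<ominus> (e \<otimes> y)" .
    have "x = e \<otimes> x \<oplus> h \<otimes> x"
      using x e(1) h(1) l_distr[of e h x] by (simp add: g_def)
    also have "\<dots> = e \<otimes> x \<oplus> (y \<oplus> \<ominus> (e \<otimes> y))" by (simp only: hx)
    also have "\<dots> = e \<otimes> (x \<oplus> \<ominus> y) \<oplus> y"
      using x e y by (simp add: r_distr r_minus a_ac)
    finally have "x = e \<otimes> (x \<oplus> \<ominus> y) \<oplus> y" .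
    moreover have "e \<otimes> (x \<oplus> \<ominus> y) \<in> I"
      using x e y by (simp add: m_assoc[symmetric])
    ultimately show "x \<in> I <+>\<^bsub>R\<^esub> J"
      using y by (auto simp: set_add_def')
  qed
  then show ?thesis using principal_right_idealI[OF g(1,2)] by simp
qed

section \<open>Finite sums of principal right ideals and spans over the center\<close>

lemma right_span_principal:
  assumes "set vs \<subseteq> carrier R"
  shows "right_span R vs \<in> principal_right_ideals R"
  using assms
  by (induction vs) (auto simp: right_span_def intro!: add_principal_right_ideals
      zero_principal_right_ideal principal_right_ideal_generated)

lemma right_span_least:
  assumes "set vs \<subseteq> I" and "I \<in> principal_right_ideals R"
  shows "right_span R vs \<subseteq> I"
  using assms(1) principal_right_ideal_closed[OF assms(2)]
  by (induction vs) (auto simp: right_span_def set_add_def' l_coset_def)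

text \<open>A central coefficient \<open>k\<close> of a generator \<open>u\<close> moves past
  \<open>u \<otimes> x\<close> and is absorbed into the right factor \<open>r\<close>. Hence
  finitely many ideals \<open>u x R\<close> cover all products of the span with
  \<open>x R\<close>.\<close>

lemma Span_center_mult_right_span:
  assumes "set us \<subseteq> carrier R" "x \<in> carrier R" "r \<in> carrier R" "s \<in> Span (ring_center R) us"
  shows "s \<otimes> (x \<otimes> r) \<in> right_span R (map (\<lambda>u. u \<otimes> x) us)"
  using assms(1,4)
proof (induction us arbitrary: s)
  case Nil
  then show ?case using assms by (simp add: right_span_def)
next
  case (Cons u us)
  obtain k t where kt: "k \<in> ring_center R" "t \<in> Span (ring_center R) us" "s = k \<otimes> u \<oplus> t"
    using Cons.prems(2) by (auto simp: line_extension_def set_add_def' r_coset_def)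
  note k = ring_center_closed[OF kt(1)] ring_center_commute[OF kt(1)]
  have u: "u \<in> carrier R" using Cons.prems by simp
  have tr: "t \<otimes> (x \<otimes> r) \<in> right_span R (map (\<lambda>u. u \<otimes> x) us)"
    using Cons kt by simp
  have "t \<in> carrier R"
  proof -
    have "Span K vs \<subseteq> carrier R" if "set vs \<subseteq> carrier R" "K \<subseteq> carrier R" for K vs
      using that by (induction vs) (auto simp: line_extension_def set_add_def' r_coset_def)
    moreover have "ring_center R \<subseteq> carrier R" using ring_center_closed by blast
    ultimately show ?thesis using kt(2) Cons.prems(1) by (auto simp del: Span.simps)
  qed
  moreover have "k \<otimes> u \<otimes> (x \<otimes> r) = u \<otimes> x \<otimes> (k \<otimes> r)"
  proof -
    have "k \<otimes> u \<otimes> (x \<otimes> r) = k \<otimes> (u \<otimes> x) \<otimes> r"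
      using k(1) u assms by (simp add: m_assoc)
    also have "\<dots> = (u \<otimes> x) \<otimes> k \<otimes> r"
      using k(2)[of "u \<otimes> x"] u assms(2) by simp
    finally show ?thesis using k(1) u assms by (simp add: m_assoc)
  qed
  ultimately have "s \<otimes> (x \<otimes> r) = u \<otimes> x \<otimes> (k \<otimes> r) \<oplus> t \<otimes> (x \<otimes> r)"
    using kt(3) k(1) u assms by (simp add: l_distr)
  moreover have "u \<otimes> x \<otimes> (k \<otimes> r) \<in> (u \<otimes> x) <# carrier R"
    using k(1) assms by (auto simp: l_coset_def)
  ultimately show ?case
    using tr by (auto simp: right_span_def set_add_def')
qed

section \<open>Rank functions and the rank metric\<close>

lemma rank_function_uminus_le:
  assumes \<rho>: "rank_function R \<rho>" and "a \<in> carrier R"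
  shows "\<rho> (\<ominus> a) \<le> \<rho> a"
proof -
  have "\<ominus> a = (\<ominus> \<one>) \<otimes> a" using assms by (simp add: l_minus)
  then show ?thesis using assms unfolding rank_function_def
    by (metis a_inv_closed min.boundedE one_closed)
qed

lemma rank_function_mult_le:
  assumes "rank_function R \<rho>" "a \<in> carrier R" "b \<in> carrier R"
  shows "\<rho> (a \<otimes> b) \<le> \<rho> a" "\<rho> (a \<otimes> b) \<le> \<rho> b"
  using assms by (auto simp: rank_function_def)

lemma rank_function_orthogonal_add:
  assumes "rank_function R \<rho>" "e \<in> carrier R" "h \<in> carrier R" "e \<otimes> e = e" "h \<otimes> h = h"
    "e \<otimes> h = \<zero>" "h \<otimes> e = \<zero>"
  shows "\<rho> (e \<oplus> h) = \<rho> e + \<rho> h"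
  using assms by (simp add: rank_function_def)

lemma rank_function_zero: "rank_function R \<rho> \<Longrightarrow> \<rho> \<zero> = 0"
  using rank_function_orthogonal_add[of \<rho> \<zero> \<zero>] by simp

lemma rank_function_nonneg: "rank_function R \<rho> \<Longrightarrow> a \<in> carrier R \<Longrightarrow> 0 \<le> \<rho> a"
  by (auto simp: rank_function_def)

lemma rank_function_pos: "rank_function R \<rho> \<Longrightarrow> a \<in> carrier R \<Longrightarrow> a \<noteq> \<zero> \<Longrightarrow> 0 < \<rho> a"
  by (auto simp: rank_function_def)

text \<open>Subadditivity is reduced to additivity on orthogonal idempotents: \<open>e\<close>
  generates \<open>a R\<close>, \<open>h\<close> is orthogonal to \<open>e\<close>, and
  \<open>e \<oplus> h\<close> fixes \<open>a \<oplus> b\<close>. As \<open>e\<close> is a right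
  multiple of \<open>a\<close> and \<open>h\<close> factors through \<open>b\<close>, their ranks
  are at most those of \<open>a\<close> and \<open>b\<close>.\<close>

lemma rank_function_add_le:
  assumes \<rho>: "rank_function R \<rho>" and a: "a \<in> carrier R" and b: "b \<in> carrier R"
  shows "\<rho> (a \<oplus> b) \<le> \<rho> a + \<rho> b"
proof -
  obtain a' where a': "a' \<in> carrier R" "a \<otimes> a' \<otimes> a = a" using regular a by blast
  define e where "e = a \<otimes> a'"
  have e: "e \<in> carrier R" "e \<otimes> e = e" "e \<otimes> a = a"
    using a a' by (auto simp: e_def m_assoc[symmetric])
  obtain h c where h: "h \<in> carrier R" "h \<otimes> h = h" "e \<otimes> h = \<zero>" "h \<otimes> e = \<zero>"
    "(e \<oplus> h) \<otimes> b = b" "c \<in> carrier R" "h = (\<one> \<ominus> e) \<otimes> b \<otimes> c"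
    using orthogonal_idempotent[OF e(1,2) b] .
  have "h \<otimes> a = h \<otimes> (e \<otimes> a)" using e by simp
  also have "\<dots> = \<zero>" using e(1) h a by (simp add: m_assoc[symmetric])
  finally have "(e \<oplus> h) \<otimes> (a \<oplus> b) = a \<oplus> b"
    using e h(1,5) a b by (simp add: r_distr l_distr[of e h a])
  then have "\<rho> (a \<oplus> b) \<le> \<rho> (e \<oplus> h)"
    using rank_function_mult_le(1)[OF \<rho>, of "e \<oplus> h" "a \<oplus> b"] e h a b by simp
  also have "\<dots> = \<rho> e + \<rho> h" using rank_function_orthogonal_add[OF \<rho>] e h by simp
  also have "\<rho> e \<le> \<rho> a" using rank_function_mult_le[OF \<rho>] a a' by (simp add: e_def)
  also have "\<rho> h \<le> \<rho> ((\<one> \<ominus> e) \<otimes> b)"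
    using rank_function_mult_le(1)[OF \<rho>, of "(\<one> \<ominus> e) \<otimes> b" c] h e b by simp
  also have "\<dots> \<le> \<rho> b" using rank_function_mult_le[OF \<rho>] e b by simp
  finally show ?thesis by simp
qed

text \<open>Bounding every element replaces a notion of rank for the right ideal itself.\<close>

lemma rank_function_right_span_le:
  assumes "rank_function R \<rho>" "set vs \<subseteq> carrier R" "g \<in> right_span R vs"
  shows "\<rho> g \<le> (\<Sum>v\<leftarrow>vs. \<rho> v)"
  using assms(2,3)
proof (induction vs arbitrary: g)
  case Nil
  then show ?case using rank_function_zero[OF assms(1)] by (simp add: right_span_def)
next
  case (Cons v vs)
  then obtain r t where rt: "r \<in> carrier R" "t \<in> right_span R vs" "g = v \<otimes> r \<oplus> t"
    by (auto simp: right_span_def set_add_def' l_coset_def)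
  have t: "t \<in> carrier R"
    using rt Cons.prems principal_right_ideal_closed(1)[OF right_span_principal[of vs]] by auto
  have v: "v \<in> carrier R" using Cons.prems by simp
  have "\<rho> g \<le> \<rho> (v \<otimes> r) + \<rho> t"
    using rank_function_add_le[OF assms(1)] rt(1,3) t v by simp
  also have "\<rho> (v \<otimes> r) \<le> \<rho> v" using rank_function_mult_le[OF assms(1)] rt(1) v by simp
  also have "\<rho> t \<le> (\<Sum>v\<leftarrow>vs. \<rho> v)" using Cons rt by simp
  finally show ?case by simp
qed

lemma Metric_space_rank_dist:
  assumes \<rho>: "rank_function R \<rho>"
  shows "Metric_space (carrier R) (rank_dist R \<rho>)"
proof
  show "0 \<le> rank_dist R \<rho> x y" for x y
    using rank_function_nonneg[OF \<rho>] by (simp add: rank_dist_def)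
  have *: "\<ominus> (x \<ominus> y) = y \<ominus> x" if "x \<in> carrier R" "y \<in> carrier R" for x y
    using that by (simp add: minus_eq minus_add a_comm)
  have "\<rho> (x \<ominus> y) \<le> \<rho> (y \<ominus> x)" if "x \<in> carrier R" "y \<in> carrier R" for x y
    using rank_function_uminus_le[OF \<rho>, of "y \<ominus> x"] *[of y x] that by simp
  then show "rank_dist R \<rho> x y = rank_dist R \<rho> y x" for x y
    by (auto simp: rank_dist_def intro: antisym)
  show "rank_dist R \<rho> x y = 0 \<longleftrightarrow> x = y" if "x \<in> carrier R" "y \<in> carrier R" for x y
  proof -
    have "\<rho> (x \<ominus> y) = 0 \<longleftrightarrow> x \<ominus> y = \<zero>"
      using rank_function_zero[OF \<rho>] rank_function_pos[OF \<rho>, of "x \<ominus> y"] minus_closed[OF that]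
      by (metis order_less_irrefl)
    then show ?thesis using that by (simp add: rank_dist_def)
  qed
  show "rank_dist R \<rho> x z \<le> rank_dist R \<rho> x y + rank_dist R \<rho> y z"
    if "x \<in> carrier R" "y \<in> carrier R" "z \<in> carrier R" for x y z
  proof -
    have "x \<ominus> z = (x \<ominus> y) \<oplus> (y \<ominus> z)"
      using that by (simp add: minus_eq a_assoc) (metis a_assoc a_inv_closed l_neg l_zero)
    then show ?thesis
      using rank_function_add_le[OF \<rho>, of "x \<ominus> y" "y \<ominus> z"] that by (simp add: rank_dist_def)
  qed
qed

text \<open>If all non-zero elements had rank at least \<open>\<epsilon>\<close>, balls of radius
  \<open>\<epsilon>\<close> would contain at most their center, and every subset would be
  open.\<close>

lemma nondiscrete_small_rank:
  assumes \<rho>: "rank_function R \<rho>"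
    and nd: "Metric_space.mtopology (carrier R) (rank_dist R \<rho>) \<noteq> discrete_topology (carrier R)"
    and "0 < \<epsilon>"
  obtains y where "y \<in> carrier R" "y \<noteq> \<zero>" "\<rho> y < \<epsilon>"
proof -
  interpret Metric_space "carrier R" "rank_dist R \<rho>" by (rule Metric_space_rank_dist[OF \<rho>])
  have "\<exists>y\<in>carrier R. y \<noteq> \<zero> \<and> \<rho> y < \<epsilon>"
  proof (rule ccontr)
    assume no: "\<not> ?thesis"
    \<comment> \<open>Inclusion rather than equality, since the ball around a point off the carrier
      is empty.\<close>
    have "mball x \<epsilon> \<subseteq> {x}" for x
    proof
      fix y assume "y \<in> mball x \<epsilon>"
      then have "x \<in> carrier R" "y \<in> carrier R" "\<rho> (x \<ominus> y) < \<epsilon>"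
        by (auto simp: mball_def rank_dist_def)
      then show "y \<in> {x}" using no by (metis minus_closed r_right_minus_eq singletonI)
    qed
    then have "openin mtopology U" if "U \<subseteq> carrier R" for U
      using that \<open>0 < \<epsilon>\<close> unfolding openin_mtopology by blast
    then have "mtopology = discrete_topology (carrier R)"
      by (auto simp: topology_eq dest: openin_subset[of mtopology, unfolded topspace_mtopology])
    then show False using nd by simp
  qed
  then show ?thesis using that by blast
qed

end

section \<open>Completeness and primeness of continuous rings\<close>

context continuous_ring
begin

text \<open>Completeness of the lattice, restated by inclusion. The join may exceed the algebraic
  sum of the ideals, so facts about it have to come from its minimality among principal right
  ideals.\<close>

lemma principal_right_ideals_Sup:
  assumes "A \<subseteq> principal_right_ideals R"
  obtains J where "J \<in> principal_right_ideals R" "\<And>I. I \<in> A \<Longrightarrow> I \<subseteq> J"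
    "\<And>K. K \<in> principal_right_ideals R \<Longrightarrow> (\<And>I. I \<in> A \<Longrightarrow> I \<subseteq> K) \<Longrightarrow> J \<subseteq> K"
proof -
  interpret L: continuous_geometry "right_ideal_lattice R" by (rule continuous_geometry)
  obtain J where "least (right_ideal_lattice R) J (Upper (right_ideal_lattice R) A)"
    using L.sup_exists[of A] assms by (auto simp: right_ideal_lattice_def)
  then have "J \<in> principal_right_ideals R" "\<forall>I\<in>A. I \<subseteq> J"
    "\<forall>K\<in>principal_right_ideals R. (\<forall>I\<in>A. I \<subseteq> K) \<longrightarrow> J \<subseteq> K"
    using assms by (auto simp: least_def Upper_def right_ideal_lattice_def)
  then show ?thesis using that[of J] by blast
qed

lemma principal_right_ideals_Inf:
  assumes "A \<subseteq> principal_right_ideals R"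
  obtains J where "J \<in> principal_right_ideals R" "\<And>I. I \<in> A \<Longrightarrow> J \<subseteq> I"
    "\<And>K. K \<in> principal_right_ideals R \<Longrightarrow> (\<And>I. I \<in> A \<Longrightarrow> K \<subseteq> I) \<Longrightarrow> K \<subseteq> J"
proof -
  interpret L: continuous_geometry "right_ideal_lattice R" by (rule continuous_geometry)
  obtain J where "greatest (right_ideal_lattice R) J (Lower (right_ideal_lattice R) A)"
    using L.inf_exists[of A] assms by (auto simp: right_ideal_lattice_def)
  then have "J \<in> principal_right_ideals R" "\<forall>I\<in>A. J \<subseteq> I"
    "\<forall>K\<in>principal_right_ideals R. (\<forall>I\<in>A. K \<subseteq> I) \<longrightarrow> K \<subseteq> J"
    using assms by (auto simp: greatest_def Lower_def right_ideal_lattice_def)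
  then show ?thesis using that[of J] by blast
qed

text \<open>The join \<open>J\<close> of all ideals generated by left multiples of \<open>f\<close>
  is two-sided, hence generated by a central idempotent. Irreducibility and
  \<open>f \<noteq> \<zero>\<close> force that idempotent to be \<open>\<one>\<close>. The right
  annihilator of \<open>y\<close> is principal and contains every \<open>r \<otimes> f\<close>, so
  it contains \<open>J\<close>, and with it \<open>\<one>\<close>.\<close>

lemma irreducible_prime:
  assumes irr: "irreducible_ring R" and f: "f \<in> carrier R" "f \<noteq> \<zero>"
    and y: "y \<in> carrier R" and fy: "\<And>r. r \<in> carrier R \<Longrightarrow> f \<otimes> r \<otimes> y = \<zero>"
  shows "y = \<zero>"
proof -
  define A where "A = {(r \<otimes> f) <# carrier R | r. r \<in> carrier R}"
  have A: "A \<subseteq> principal_right_ideals R"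
    using f by (auto simp: A_def principal_right_ideals_def)
  obtain J where J: "J \<in> principal_right_ideals R" "\<And>I. I \<in> A \<Longrightarrow> I \<subseteq> J"
    "\<And>K. K \<in> principal_right_ideals R \<Longrightarrow> (\<And>I. I \<in> A \<Longrightarrow> I \<subseteq> K) \<Longrightarrow> J \<subseteq> K"
    using principal_right_ideals_Sup[OF A] by blast
  have rf: "(r \<otimes> f) \<otimes> s \<in> J" if "r \<in> carrier R" "s \<in> carrier R" for r s
    using J(2)[of "(r \<otimes> f) <# carrier R"] that by (auto simp: A_def l_coset_def)
  have two_sided: "a \<otimes> x \<in> J" if a: "a \<in> carrier R" and x: "x \<in> J" for a x
  proof -
    \<comment> \<open>The preimage of \<open>J\<close> under left multiplication by \<open>a\<close>
      is principal and contains the generating ideals, because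
      \<open>a \<otimes> (r \<otimes> f)\<close> is again a left multiple of \<open>f\<close>;
      minimality of \<open>J\<close> does the rest.\<close>
    have "J \<subseteq> {x \<in> carrier R. a \<otimes> x \<in> J}"
    proof (rule J(3))
      show "{x \<in> carrier R. a \<otimes> x \<in> J} \<in> principal_right_ideals R"
        by (rule left_multiplication_preimage_principal[OF J(1) a])
      fix I assume "I \<in> A"
      then obtain r where r: "r \<in> carrier R" "I = (r \<otimes> f) <# carrier R" by (auto simp: A_def)
      have "a \<otimes> (r \<otimes> f \<otimes> s) \<in> J" if "s \<in> carrier R" for s
        using rf[of "a \<otimes> r" s] a r(1) f that by (simp add: m_assoc)
      then show "I \<subseteq> {x \<in> carrier R. a \<otimes> x \<in> J}" using r f by (auto simp: l_coset_def)
    qed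
    then show ?thesis using x by auto
  qed
  obtain e where e: "e \<in> carrier R" "e \<otimes> e = e" "J = {x \<in> carrier R. e \<otimes> x = x}"
    using principal_right_idealE[OF J(1)] .
  define u where "u = \<one> \<ominus> e"
  have u: "u \<in> carrier R" "u \<otimes> e = \<zero>"
    using one_minus_idempotent[OF e(1,2)] e(1) by (auto simp: u_def)
  have ere: "e \<otimes> (r \<otimes> e) = r \<otimes> e" if "r \<in> carrier R" for r
    using two_sided[OF that, of e] e by simp
  have uRe: "u \<otimes> (r \<otimes> e) = \<zero>" if "r \<in> carrier R" for r
    using ere[OF that] that e(1) one_minus_mult_eq_zero_iff[of e "r \<otimes> e"] by (simp add: u_def)
  \<comment> \<open>Regularity turns \<open>u R e = 0\<close> into \<open>e R u = 0\<close>: in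
    \<open>x \<otimes> b \<otimes> x\<close> the middle factor
    \<open>u \<otimes> b \<otimes> e\<close> vanishes. Both together make \<open>e\<close>
    central.\<close>
  have eRu: "e \<otimes> r \<otimes> u = \<zero>" if r: "r \<in> carrier R" for r
  proof -
    define x where "x = e \<otimes> r \<otimes> u"
    have xc: "x \<in> carrier R" using e u r by (simp add: x_def)
    obtain b where b: "b \<in> carrier R" "x \<otimes> b \<otimes> x = x" using regular xc by blast
    have "x \<otimes> b \<otimes> x = (e \<otimes> r) \<otimes> ((u \<otimes> (b \<otimes> e)) \<otimes> (r \<otimes> u))"
      using e(1) u(1) r b(1) by (simp add: x_def m_assoc)
    also have "\<dots> = \<zero>" using uRe[OF b(1)] e(1) u(1) r by simp
    finally show ?thesis using b by (simp add: x_def)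
  qed
  have "e \<otimes> r = r \<otimes> e" if r: "r \<in> carrier R" for r
  proof -
    have "e \<otimes> r \<otimes> u = e \<otimes> r \<ominus> e \<otimes> r \<otimes> e"
      using e(1) r by (simp add: u_def minus_eq r_distr r_minus)
    then have "e \<otimes> r = e \<otimes> r \<otimes> e"
      using eRu[OF r] e(1) r r_right_minus_eq[of "e \<otimes> r" "e \<otimes> r \<otimes> e"] by simp
    then show ?thesis using ere[OF r] e(1) r by (simp add: m_assoc)
  qed
  then have "e \<in> ring_center R" using e(1) unfolding ring_center_def by blast
  then have "e = \<zero> \<or> e = \<one>"
    using irreducible_central_idempotent[OF irr _ e(2)] by blast
  moreover have "f \<in> J" using rf[of \<one> \<one>] f by simp
  then have "e \<noteq> \<zero>" using e f by auto
  ultimately have oneJ: "\<one> \<in> J" using e by auto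
  \<comment> \<open>The same device exchanges the sides: \<open>x \<otimes> b \<otimes> x\<close>
    contains \<open>f \<otimes> b \<otimes> y\<close>, which is zero by assumption.\<close>
  have yRf: "y \<otimes> r \<otimes> f = \<zero>" if r: "r \<in> carrier R" for r
  proof -
    define x where "x = y \<otimes> r \<otimes> f"
    have xc: "x \<in> carrier R" using y f r by (simp add: x_def)
    obtain b where b: "b \<in> carrier R" "x \<otimes> b \<otimes> x = x" using regular xc by blast
    have "x \<otimes> b \<otimes> x = (y \<otimes> r) \<otimes> ((f \<otimes> b \<otimes> y) \<otimes> (r \<otimes> f))"
      using y f(1) r b(1) by (simp add: x_def m_assoc)
    also have "\<dots> = \<zero>" using fy[OF b(1)] y f(1) r by simp
    finally show ?thesis using b by (simp add: x_def)
  qed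
  have "J \<subseteq> {x \<in> carrier R. y \<otimes> x = \<zero>}"
  proof (rule J(3))
    show "{x \<in> carrier R. y \<otimes> x = \<zero>} \<in> principal_right_ideals R"
      by (rule right_annihilator_principal[OF y])
    fix I assume "I \<in> A"
    then obtain r where r: "r \<in> carrier R" "I = (r \<otimes> f) <# carrier R" by (auto simp: A_def)
    have "y \<otimes> (r \<otimes> f \<otimes> s) = \<zero>" if "s \<in> carrier R" for s
    proof -
      have "y \<otimes> (r \<otimes> f \<otimes> s) = (y \<otimes> r \<otimes> f) \<otimes> s" using y r(1) f(1) that by (simp add: m_assoc)
      then show ?thesis using yRf[OF r(1)] that by simp
    qed
    then show "I \<subseteq> {x \<in> carrier R. y \<otimes> x = \<zero>}" using r f by (auto simp: l_coset_def)
  qed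
  then show ?thesis using oneJ y by auto
qed

text \<open>Excludes gaps among invariant ideals. The ideal is \<open>I + N\<close>, where
  \<open>N\<close> is the right ideal generated by \<open>S x\<close> for some \<open>x\<close> of
  small rank in \<open>f R\<close>; \<open>x\<close> witnesses that it exceeds \<open>I\<close>, and
  \<open>f\<close> that it misses part of \<open>J\<close>.\<close>

lemma invariant_ideal_strictly_between:
  assumes irr: "irreducible_ring R" and nd: "nondiscrete_ring R"
    and S: "subring S R" and us: "set us \<subseteq> S" "Span (ring_center R) us = S"
    and I: "I \<in> principal_right_ideals R" "\<And>a. a \<in> S \<Longrightarrow> a <# I \<subseteq> I"
    and J: "J \<in> principal_right_ideals R" "\<And>a. a \<in> S \<Longrightarrow> a <# J \<subseteq> J"
    and IJ: "I \<subset> J"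
  obtains G where "G \<in> principal_right_ideals R" "\<And>a. a \<in> S \<Longrightarrow> a <# G \<subseteq> G" "I \<subset> G" "G \<subset> J"
proof -
  interpret S: subring S R by (rule S)
  have Sc: "\<And>s. s \<in> S \<Longrightarrow> s \<in> carrier R" using S.subset by blast
  note Iclosed = principal_right_ideal_closed[OF I(1)]
  note Jclosed = principal_right_ideal_closed[OF J(1)]
  obtain \<rho> where \<rho>: "rank_function R \<rho>" and
    top: "Metric_space.mtopology (carrier R) (rank_dist R \<rho>) \<noteq> discrete_topology (carrier R)"
    using nd by (auto simp: nondiscrete_ring_def)
  obtain e where e: "e \<in> carrier R" "e \<otimes> e = e" "I = {x \<in> carrier R. e \<otimes> x = x}"
    using principal_right_idealE[OF I(1)] .
  obtain b where b: "b \<in> J" "b \<notin> I" using IJ by blast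
  have bc: "b \<in> carrier R" using b Jclosed(1) by blast
  obtain f c where f: "f \<in> carrier R" "f \<otimes> f = f" "e \<otimes> f = \<zero>" "f \<otimes> e = \<zero>"
    "(e \<oplus> f) \<otimes> b = b" "c \<in> carrier R" "f = (\<one> \<ominus> e) \<otimes> b \<otimes> c"
    using orthogonal_idempotent[OF e(1,2) bc] .
  have f_nonzero: "f \<noteq> \<zero>" using f(5) b bc e by auto
  have fJ: "f \<in> J"
  proof -
    have "(\<one> \<ominus> e) \<otimes> b = b \<oplus> e \<otimes> (\<ominus> b)"
      using e bc by (simp add: minus_eq l_distr l_minus r_minus)
    moreover have "e \<in> J" using IJ e by auto
    ultimately have "(\<one> \<ominus> e) \<otimes> b \<in> J" using Jclosed b bc by simp
    then show ?thesis using Jclosed(4) f(6,7) by blast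
  qed
  \<comment> \<open>Left multiplication by \<open>f\<close> kills \<open>I\<close> and fixes
    \<open>x\<close> and \<open>f\<close>, so it detects what lies outside \<open>I\<close>.\<close>
  have fI: "f \<otimes> i = \<zero>" if "i \<in> I" for i
  proof -
    have "f \<otimes> i = f \<otimes> (e \<otimes> i)" using that e by simp
    also have "\<dots> = (f \<otimes> e) \<otimes> i" using that e(1,3) f(1) by (simp add: m_assoc)
    finally show ?thesis using that e(3) f(4) by simp
  qed
  define n where "n = real (length us)"
  have fpos: "0 < \<rho> f" using rank_function_pos[OF \<rho> f(1) f_nonzero] .
  \<comment> \<open>The denominator \<open>n + 1\<close> covers an empty list of generators and
    makes the later bound by \<open>\<rho> f\<close> strict.\<close>
  then have "0 < \<rho> f / (n + 1)" by (simp add: n_def)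
  then obtain y where y: "y \<in> carrier R" "y \<noteq> \<zero>" "\<rho> y < \<rho> f / (n + 1)"
    using nondiscrete_small_rank[OF \<rho> top] by blast
  \<comment> \<open>Primeness carries the small element \<open>y\<close> into \<open>f R\<close>
    without annihilating it; the product has rank at most that of \<open>y\<close>.\<close>
  obtain r where r: "r \<in> carrier R" "f \<otimes> r \<otimes> y \<noteq> \<zero>"
    using irreducible_prime[OF irr f(1) f_nonzero y(1)] y(2) by blast
  define x where "x = f \<otimes> r \<otimes> y"
  have xc: "x \<in> carrier R" using f r y by (simp add: x_def)
  have fx: "f \<otimes> x = x"
    using f(1,2) r(1) y(1) by (simp add: x_def m_assoc[symmetric])
  have xJ: "x \<in> J" using Jclosed(4)[OF fJ xc] fx by simp
  have xI: "x \<notin> I" using fI[of x] fx r by (auto simp: x_def)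
  have "\<rho> x \<le> \<rho> y" using rank_function_mult_le(2)[OF \<rho>, of "f \<otimes> r" y] f r y by (simp add: x_def)
  then have "n * \<rho> x \<le> n * (\<rho> f / (n + 1))" using y(3) by (intro mult_left_mono) (auto simp: n_def)
  also have "\<dots> < \<rho> f" using fpos by (simp add: field_simps n_def)
  finally have small: "n * \<rho> x < \<rho> f" .

  define vs where "vs = map (\<lambda>u. u \<otimes> x) us"
  define N where "N = right_span R vs"
  have vs: "set vs \<subseteq> carrier R" "set vs \<subseteq> J"
    using us(1) Sc xc J(2) xJ by (auto simp: vs_def l_coset_def)
  have N: "N \<in> principal_right_ideals R" using right_span_principal[OF vs(1)] by (simp add: N_def)
  note Nclosed = principal_right_ideal_closed[OF N]
  have sxN: "s \<otimes> (x \<otimes> t) \<in> N" if "s \<in> S" "t \<in> carrier R" for s t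
  proof -
    have "set us \<subseteq> carrier R" using us(1) Sc by blast
    then show ?thesis
      using Span_center_mult_right_span[of us x t s] xc that us(2) unfolding N_def vs_def by blast
  qed
  \<comment> \<open>It suffices to test the generators \<open>u \<otimes> x\<close>, by minimality
    of the right span; there \<open>a \<otimes> u\<close> lies in \<open>S\<close> again.\<close>
  have N_invariant: "a \<otimes> g \<in> N" if a: "a \<in> S" and g: "g \<in> N" for a g
  proof -
    have "N \<subseteq> {z \<in> carrier R. a \<otimes> z \<in> N}"
      unfolding N_def
    proof (rule right_span_least)
      show "{z \<in> carrier R. a \<otimes> z \<in> right_span R vs} \<in> principal_right_ideals R"
        using left_multiplication_preimage_principal[OF N Sc[OF a]] by (simp add: N_def)
      have "a \<otimes> (u \<otimes> x) \<in> right_span R vs" if "u \<in> set us" for u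
      proof -
        have u: "u \<in> S" using that us by blast
        then have "a \<otimes> u \<otimes> (x \<otimes> \<one>) \<in> N" using sxN[of "a \<otimes> u" \<one>] a by simp
        then show ?thesis using Sc[OF a] Sc[OF u] xc by (simp add: N_def m_assoc)
      qed
      then show "set vs \<subseteq> {z \<in> carrier R. a \<otimes> z \<in> right_span R vs}"
        using vs(1) by (auto simp: vs_def)
    qed
    then show ?thesis using g by blast
  qed
  define G where "G = I <+>\<^bsub>R\<^esub> N"
  have "x \<in> N" using sxN[of \<one> \<one>] xc by simp
  then have xG: "x \<in> G" using Iclosed(2) xc by (force simp: G_def set_add_def')
  have IG: "I \<subseteq> G"
  proof
    fix i assume "i \<in> I"
    then show "i \<in> G" using Nclosed(2) Iclosed(1) by (force simp: G_def set_add_def')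
  qed
  have GJ: "G \<subseteq> J"
    using right_span_least[OF vs(2) J(1)] IJ Jclosed(3) by (auto simp: G_def N_def set_add_def')
  \<comment> \<open>From \<open>f = i \<oplus> g\<close> follows \<open>f = f \<otimes> g\<close>,
    since \<open>f\<close> is idempotent and kills \<open>i\<close>. Then
    \<open>\<rho> f \<le> \<rho> g \<le> n * \<rho> x\<close>, contrary to the choice of
    \<open>x\<close>.\<close>
  have "f \<notin> G"
  proof
    assume "f \<in> G"
    then obtain i g where ig: "i \<in> I" "g \<in> N" "f = i \<oplus> g" by (auto simp: G_def set_add_def')
    have gc: "g \<in> carrier R" and ic: "i \<in> carrier R" using ig Nclosed(1) Iclosed(1) by auto
    have "f \<otimes> (i \<oplus> g) = f \<otimes> g" using gc ic fI[OF ig(1)] f(1) by (simp add: r_distr)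
    then have "f = f \<otimes> g" using f(2) ig(3) by simp
    then have "\<rho> f \<le> \<rho> g" using rank_function_mult_le(2)[OF \<rho> f(1) gc] by simp
    also have "\<dots> \<le> (\<Sum>v\<leftarrow>vs. \<rho> v)"
      using rank_function_right_span_le[OF \<rho> vs(1)] ig by (simp add: N_def)
    also have "\<dots> = (\<Sum>u\<leftarrow>us. \<rho> (u \<otimes> x))" by (simp add: vs_def comp_def)
    also have "\<dots> \<le> (\<Sum>u\<leftarrow>us. \<rho> x)"
      using us(1) Sc xc rank_function_mult_le(2)[OF \<rho>] by (intro sum_list_mono) blast
    also have "\<dots> = n * \<rho> x" by (simp add: n_def sum_list_triv)
    finally show False using small by simp
  qed
  moreover have "a <# G \<subseteq> G" if a: "a \<in> S" for a
  proof
    fix z assume "z \<in> a <# G"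
    then obtain i g where ig: "i \<in> I" "g \<in> N" "z = a \<otimes> (i \<oplus> g)"
      by (auto simp: G_def set_add_def' l_coset_def)
    have "z = a \<otimes> i \<oplus> a \<otimes> g"
      using ig Nclosed(1) Iclosed(1) Sc[OF a] by (auto intro!: r_distr)
    moreover have "a \<otimes> i \<in> I" using I(2)[OF a] ig(1) by (auto simp: l_coset_def)
    ultimately show "z \<in> G" using N_invariant[OF a ig(2)] by (auto simp: G_def set_add_def')
  qed
  ultimately show ?thesis
    using that[of G] add_principal_right_ideals[OF I(1) N] IG GJ xG xI fJ by (auto simp: G_def)
qed

end

section \<open>From a maximal chain of invariant ideals to a maximal chain\<close>

theorem theorem9p11:
  fixes R :: "('a, 'm) ring_scheme" and S :: "'a set"
  assumes "continuous_ring R"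
    and "irreducible_ring R"
    and "nondiscrete_ring R"
    and "subring S R"
    and "ring_center R \<subseteq> S"
    and "module_dim R (ring_center R) S < \<infinity>"
  shows "\<exists>F. subset.maxchain (principal_right_ideals R) F \<and> S \<subseteq> stabilizer_ring R F"
proof -
  interpret continuous_ring R by (rule assms(1))
  have Sc: "\<And>s. s \<in> S \<Longrightarrow> s \<in> carrier R"
    using subringE(1)[OF assms(4)] by blast
  \<comment> \<open>An infimum below \<open>\<infinity>\<close> cannot be taken over the empty set,
    so a finite generating list exists.\<close>
  obtain us where us: "set us \<subseteq> S" "Span (ring_center R) us = S"
    using assms(6) unfolding module_dim_def top_enat_def[symmetric] INF_less_iff
    by blast
  define L where "L = {I \<in> principal_right_ideals R. \<forall>a\<in>S. a <#\<^bsub>R\<^esub> I \<subseteq> I}"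
  obtain F where F: "subset.maxchain L F" using subset.Hausdorff[of L] by blast
  have FL: "F \<subseteq> L" and chain: "\<And>M Y. M \<in> F \<Longrightarrow> Y \<in> F \<Longrightarrow> M \<subseteq> Y \<or> Y \<subseteq> M"
    using F by (auto simp: subset.maxchain_def subset.chain_def)
  have maximal: "M \<in> F" if "M \<in> L" "\<And>Y. Y \<in> F \<Longrightarrow> M \<subseteq> Y \<or> Y \<subseteq> M" for M
  proof (rule ccontr)
    assume "M \<notin> F"
    moreover have "subset.chain L (insert M F)"
      using FL chain that by (fastforce simp: subset.chain_def)
    ultimately show False using F unfolding subset.maxchain_def by blast
  qed
  \<comment> \<open>Maximality among invariant ideals is upgraded here: \<open>M\<close> is an
    arbitrary principal right ideal, invariant or not.\<close>
  have comparable_mem: "M \<in> F"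
    if M: "M \<in> principal_right_ideals R" and comparable: "\<And>Y. Y \<in> F \<Longrightarrow> M \<subseteq> Y \<or> Y \<subseteq> M" for M
  proof (rule ccontr)
    assume MF: "M \<notin> F"
    have lower: "{Y \<in> F. Y \<subseteq> M} \<subseteq> principal_right_ideals R"
      and upper: "{Y \<in> F. M \<subseteq> Y} \<subseteq> principal_right_ideals R"
      using FL by (auto simp: L_def)
    \<comment> \<open>\<open>I\<close> is the join of the members below \<open>M\<close> and
      \<open>J\<close> the meet of those above it. Each member of \<open>F\<close> therefore lies
      below \<open>I\<close> or above \<open>J\<close>; empty families are covered by
      completeness.\<close>
    obtain I where I: "I \<in> principal_right_ideals R" "\<And>Y. Y \<in> {Y \<in> F. Y \<subseteq> M} \<Longrightarrow> Y \<subseteq> I"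
      "\<And>K. K \<in> principal_right_ideals R \<Longrightarrow> (\<And>Y. Y \<in> {Y \<in> F. Y \<subseteq> M} \<Longrightarrow> Y \<subseteq> K) \<Longrightarrow> I \<subseteq> K"
      using principal_right_ideals_Sup[OF lower] by blast
    obtain J where J: "J \<in> principal_right_ideals R" "\<And>Y. Y \<in> {Y \<in> F. M \<subseteq> Y} \<Longrightarrow> J \<subseteq> Y"
      "\<And>K. K \<in> principal_right_ideals R \<Longrightarrow> (\<And>Y. Y \<in> {Y \<in> F. M \<subseteq> Y} \<Longrightarrow> K \<subseteq> Y) \<Longrightarrow> K \<subseteq> J"
      using principal_right_ideals_Inf[OF upper] by blast
    have IM: "I \<subseteq> M" using I(3)[OF M] by blast
    have MJ: "M \<subseteq> J" using J(3)[OF M] by blast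
    have invI: "a <#\<^bsub>R\<^esub> I \<subseteq> I" if a: "a \<in> S" for a
    proof -
      have "I \<subseteq> {x \<in> carrier R. a \<otimes>\<^bsub>R\<^esub> x \<in> I}"
      proof (rule I(3)[OF left_multiplication_preimage_principal[OF I(1) Sc[OF a]]])
        fix Y assume Y: "Y \<in> {Y \<in> F. Y \<subseteq> M}"
        then have "Y \<in> L" using FL by blast
        then have "a <#\<^bsub>R\<^esub> Y \<subseteq> Y" "Y \<subseteq> carrier R"
          using a principal_right_ideal_closed(1) by (auto simp: L_def)
        then show "Y \<subseteq> {x \<in> carrier R. a \<otimes>\<^bsub>R\<^esub> x \<in> I}"
          using I(2)[OF Y] by (auto simp: l_coset_def)
      qed
      then show ?thesis by (auto simp: l_coset_def)
    qed
    have invJ: "a <#\<^bsub>R\<^esub> J \<subseteq> J" if a: "a \<in> S" for a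
    \<comment> \<open>Dually to the join, the image of \<open>J\<close> under \<open>a\<close> is
      principal and lies below every member above \<open>M\<close>, hence below their meet.\<close>
    proof (rule J(3)[OF left_multiplication_image_principal[OF J(1) Sc[OF a]]])
      fix Y assume Y: "Y \<in> {Y \<in> F. M \<subseteq> Y}"
      then have "a <#\<^bsub>R\<^esub> Y \<subseteq> Y" using FL a by (auto simp: L_def)
      then show "a <#\<^bsub>R\<^esub> J \<subseteq> Y" using J(2)[OF Y] by (auto simp: l_coset_def)
    qed
    have "I \<in> F"
    proof (rule maximal)
      show "I \<in> L" using I(1) invI by (simp add: L_def)
      show "I \<subseteq> Y \<or> Y \<subseteq> I" if "Y \<in> F" for Y
        using comparable[OF that] I(2)[of Y] that IM by auto
    qed
    moreover have "J \<in> F"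
    proof (rule maximal)
      show "J \<in> L" using J(1) invJ by (simp add: L_def)
      show "J \<subseteq> Y \<or> Y \<subseteq> J" if "Y \<in> F" for Y
        using comparable[OF that] J(2)[of Y] that MJ by auto
    qed
    ultimately have "I \<noteq> M" "J \<noteq> M" using MF by auto
    then have "I \<noteq> J" using IM MJ by auto
    then have "I \<subset> J" using IM MJ by auto
    then obtain G where G: "G \<in> principal_right_ideals R" "\<And>a. a \<in> S \<Longrightarrow> a <#\<^bsub>R\<^esub> G \<subseteq> G"
        "I \<subset> G" "G \<subset> J"
      using invariant_ideal_strictly_between[OF assms(2,3,4) us I(1) invI J(1) invJ] by blast
    have "G \<in> F"
    proof (rule maximal)
      show "G \<in> L" using G by (simp add: L_def)
      show "G \<subseteq> Y \<or> Y \<subseteq> G" if "Y \<in> F" for Y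
        using comparable[OF that] I(2)[of Y] J(2)[of Y] that G(3,4) by auto
    qed
    \<comment> \<open>As a member of \<open>F\<close>, \<open>G\<close> is comparable with
      \<open>M\<close>; by the choice of \<open>I\<close> and \<open>J\<close> this gives
      \<open>G \<subseteq> I\<close> or \<open>J \<subseteq> G\<close>.\<close>
    then show False using comparable[of G] I(2)[of G] J(2)[of G] G(3,4) by auto
  qed
  \<comment> \<open>A new member of a larger chain would be comparable with all of \<open>F\<close>,
    hence already in \<open>F\<close>.\<close>
  have "\<not> F \<subset> T" if T: "subset.chain (principal_right_ideals R) T" for T
  proof
    assume "F \<subset> T"
    then obtain M where M: "M \<in> T" "M \<notin> F" and FT: "F \<subseteq> T" by blast
    have "M \<in> principal_right_ideals R" "\<And>Y. Y \<in> T \<Longrightarrow> M \<subseteq> Y \<or> Y \<subseteq> M"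
      using T M(1) by (auto simp: subset_chain_def)
    then show False using comparable_mem[of M] M(2) FT by auto
  qed
  moreover have "subset.chain (principal_right_ideals R) F"
    using FL chain by (auto simp: subset_chain_def L_def)
  ultimately have "subset.maxchain (principal_right_ideals R) F"
    by (auto simp: subset.maxchain_def)
  moreover have "S \<subseteq> stabilizer_ring R F"
    using FL Sc by (auto simp: stabilizer_ring_def L_def)
  ultimately show ?thesis by blast
qed

end
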